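(* Let $D$ be a domain in $\mathbb C$ and let $n\geq 1$ be an integer. Then $D$ is Carathéodory hyperbolic if and only if $S_n(D)$ is Carathéodory hyperbolic. Consequently, $D$ is $c$-finitely compact if and only if $S_n(D)$ is $c$-finitely compact.
   Context: $\mathbb D$ is the open unit disc in $\mathbb C$ and $p$ is the Poincaré distance on $\mathbb D$ (so $p(0,\sigma)=\operatorname{artanh}|\sigma|$). $\pi_n:\mathbb C^n\to\mathbb C^n$ is the symmetrization map, $\pi_n(\lambda_1,\ldots,\lambda_n)=(\sigma_1(\lambda),\ldots,\sigma_n(\lambda))$, where $\sigma_j$ is the $j$-th elementary symmetric polynomial. For a domain $D\subset\mathbb C$, $S_n(D):=\pi_n(D^n)$, which is a domain in $\mathbb C^n$. For a domain $\Omega\subset\mathbb C^n$, the Carathéodory pseudodistance is $c_\Omega(w,z)=\sup\{p(0,F(z)):F\in\mathcal O(\Omega,\mathbb D),\ F(w)=0\}$. $\Omega$ is Carathéodory hyperbolic if $c_\Omega(w,z)>0$ for all $w,z\in\Omega$, $w\neq z$. $\Omega$ is $c$-finitely compact if it is Carathéodory hyperbolic and for any sequence $(z_k)_{k\ge1}\subset\Omega$ without accumulation point in $\Omega$ we have $c_\Omega(z_1,z_k)\to\infty$ as $k\to\infty$. *)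

theory Defs
  imports "HOL-Complex_Analysis.Complex_Analysis"
begin

definition is_domain :: "'a::topological_space set \<Rightarrow> bool" where
  "is_domain \<Omega> \<longleftrightarrow> open \<Omega> \<and> connected \<Omega> \<and> \<Omega> \<noteq> {}"

text \<open>
  The normalization is the one with \<open>poincare_dist 0 \<sigma> = artanh (cmod \<sigma>)\<close>.
\<close>

definition poincare_dist :: "complex \<Rightarrow> complex \<Rightarrow> real" where
  "poincare_dist a b = artanh (cmod ((a - b) / (1 - cnj a * b)))"

text \<open>
  Holomorphy in several variables: existence of a complex linear Frechet derivative at every
  point.  \<open>has_derivative\<close> supplies a bounded real linear map, so only homogeneity with
  respect to complex scalars has to be added.
\<close>

definition holomorphic_vec_on :: "(complex ^ 'n \<Rightarrow> complex) \<Rightarrow> (complex ^ 'n) set \<Rightarrow> bool"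
    (infixl \<open>holomorphic'_vec'_on\<close> 50) where
  "F holomorphic_vec_on \<Omega> \<longleftrightarrow>
     (\<forall>z\<in>\<Omega>. \<exists>F'. (F has_derivative F') (at z within \<Omega>) \<and> (\<forall>c v. F' (c *s v) = c * F' v))"

definition disc_maps :: "complex set \<Rightarrow> (complex \<Rightarrow> complex) set" where
  "disc_maps \<Omega> = {F. F holomorphic_on \<Omega> \<and> F ` \<Omega> \<subseteq> ball 0 1}"

definition disc_maps_vec :: "(complex ^ 'n) set \<Rightarrow> (complex ^ 'n \<Rightarrow> complex) set" where
  "disc_maps_vec \<Omega> = {F. F holomorphic_vec_on \<Omega> \<and> F ` \<Omega> \<subseteq> ball 0 1}"

text \<open>
  The types \<open>complex\<close> and \<open>complex ^ 'n\<close> have no common library notion of holomorphy, so the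
  following definitions take the assignment \<open>\<O>\<close> of the family of holomorphic maps into
  the unit disc to a set as a parameter; it is instantiated by \<open>disc_maps\<close> or
  \<open>disc_maps_vec\<close>.
\<close>

definition caratheodory_dist ::
    "('a set \<Rightarrow> ('a \<Rightarrow> complex) set) \<Rightarrow> 'a set \<Rightarrow> 'a \<Rightarrow> 'a \<Rightarrow> ereal" where
  "caratheodory_dist \<O> \<Omega> w z = (SUP F \<in> {F \<in> \<O> \<Omega>. F w = 0}. ereal (poincare_dist 0 (F z)))"

definition caratheodory_hyperbolic ::
    "('a set \<Rightarrow> ('a \<Rightarrow> complex) set) \<Rightarrow> 'a set \<Rightarrow> bool" where
  "caratheodory_hyperbolic \<O> \<Omega> \<longleftrightarrow>
     (\<forall>w\<in>\<Omega>. \<forall>z\<in>\<Omega>. w \<noteq> z \<longrightarrow> caratheodory_dist \<O> \<Omega> w z > 0)"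

text \<open>
  An accumulation point of a sequence is a limit of a subsequence (not a limit point of its
  range).
\<close>

definition c_finitely_compact ::
    "('a::metric_space set \<Rightarrow> ('a \<Rightarrow> complex) set) \<Rightarrow> 'a set \<Rightarrow> bool" where
  "c_finitely_compact \<O> \<Omega> \<longleftrightarrow>
     caratheodory_hyperbolic \<O> \<Omega> \<and>
     (\<forall>z::nat \<Rightarrow> 'a. range z \<subseteq> \<Omega> \<and>
        \<not> (\<exists>a\<in>\<Omega>. \<exists>r. strict_mono r \<and> (z \<circ> r) \<longlonglongrightarrow> a) \<longrightarrow>
        (\<lambda>k. caratheodory_dist \<O> \<Omega> (z 0) (z k)) \<longlonglongrightarrow> \<infinity>)"

definition elem_sym :: "nat \<Rightarrow> complex ^ 'n \<Rightarrow> complex" where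
  "elem_sym k x = (\<Sum>A | card A = k. \<Prod>i\<in>A. x $ i)"

text \<open>
  The coordinates are numbered \<open>1, \<dots>, CARD('n)\<close> along the order of the index type:
  \<open>card {..i}\<close> is the position of \<open>i\<close>.
\<close>

definition symmetrization ::
    "complex ^ 'n::{finite,linorder} \<Rightarrow> complex ^ 'n::{finite,linorder}" where
  "symmetrization x = (\<chi> i. elem_sym (card {..i}) x)"

definition sym_product :: "complex set \<Rightarrow> (complex ^ 'n::{finite,linorder}) set" where
  "sym_product D = symmetrization ` {x. \<forall>i. x $ i \<in> D}"

end

theory Submission
  imports Defs
begin

text \<open>
  For \<open>g\<close> holomorphic on \<open>D\<close>, the function \<open>w \<mapsto> \<Sum>\<^sub>i g (\<rho>\<^sub>i w)\<close>, where \<open>\<rho> w \<in> D\<^sup>n\<close> is any tuple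
  with \<open>\<pi> (\<rho> w) = w\<close>, is holomorphic on \<open>S\<^sub>n(D)\<close>: near a point \<open>z\<close> with root polynomial \<open>P\<close>, divide
  \<open>g = Q + P\<^sup>2 h\<close>.  The polynomial \<open>Q\<close> contributes power sums, which are polynomials in \<open>w\<close> by
  Newton's identities, and \<open>P (\<rho>\<^sub>i w) = O(\<bar>w - z\<bar>)\<close>, so the rest has derivative \<open>0\<close> at \<open>z\<close>.

  If \<open>D\<close> is hyperbolic, some such \<open>g\<close> vanishes at all roots of two given points except one whose
  multiplicities differ, and the sum separates the two points.  For finite compactness, take a disc map
  \<open>f\<close> with \<open>f (\<rho>\<^sub>j w)\<close> positive and near \<open>1\<close>: the Cayley transforms of \<open>f\<close> add up to a map into the
  right half plane whose real part at \<open>w\<close> is large, while at the base point it stays bounded because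
  \<open>c\<^sub>D\<close> is finite.  Conversely, \<open>t \<mapsto> \<pi>(t, a, \<dots>, a)\<close> embeds \<open>D\<close> into \<open>S\<^sub>n(D)\<close> without increasing
  the Caratheodory distance.
\<close>

no_notation fps_nth (infixl \<open>$\<close> 75)

subsection \<open>Elementary symmetric functions and power sums\<close>

text \<open>The \<open>k\<close>-th elementary symmetric function read off the point \<open>w\<close>: the sum has at most one term,
  and none if \<open>k\<close> exceeds the dimension.\<close>

definition sym_coord :: "complex ^ 'n::{finite,linorder} \<Rightarrow> nat \<Rightarrow> complex" where
  "sym_coord w k = (if k = 0 then 1 else \<Sum>i | card {..i} = k. w $ i)"

text \<open>Strict monotonicity gives injectivity, and counting then gives surjectivity. Sums over
  the index type can thereby be rewritten as sums over the degrees 1 to n.\<close>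

lemma bij_betw_card_atMost: "bij_betw (\<lambda>i::'n::{finite,linorder}. card {..i}) UNIV {1..CARD('n)}"
proof -
  have "strict_mono (\<lambda>i::'n. card {..i})"
    by (intro strict_monoI psubset_card_mono) auto
  then have inj: "inj (\<lambda>i::'n. card {..i})"
    by (rule strict_mono_imp_inj_on)
  have "range (\<lambda>i::'n. card {..i}) \<subseteq> {1..CARD('n)}"
    by (auto simp: Suc_le_eq card_gt_0_iff intro!: card_mono)
  then have "range (\<lambda>i::'n. card {..i}) = {1..CARD('n)}"
    by (rule card_subset_eq[rotated]) (simp_all add: card_image[OF inj])
  with inj show ?thesis
    by (simp add: bij_betw_def)
qed

lemma elem_sym_0 [simp]: "elem_sym 0 x = 1"
proof -
  have "{A :: 'a::finite set. card A = 0} = {{}}" by auto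
  then show ?thesis by (simp add: elem_sym_def)
qed

lemma elem_sym_eq_0:
  fixes x :: "complex ^ 'n::finite"
  assumes "k > CARD('n)"
  shows "elem_sym k x = 0"
proof -
  have "card A \<le> CARD('n)" for A :: "'n set"
    by (simp add: card_mono)
  with assms have "{A :: 'n set. card A = k} = {}"
    by (auto simp: leD)
  then show ?thesis
    by (simp only: elem_sym_def sum.empty)
qed

lemma sym_coord_symmetrization:
  fixes x :: "complex ^ 'n::{finite,linorder}"
  shows "sym_coord (symmetrization x) k = elem_sym k x"
proof (cases "k \<in> {1..CARD('n)}")
  case True
  then have "k \<in> range (\<lambda>i::'n. card {..i})"
    using bij_betw_card_atMost[where 'n='n] by (simp only: bij_betw_def)
  then obtain j :: 'n where j: "card {..j} = k"
    by auto
  have "{i :: 'n. card {..i} = k} = {j}"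
    using bij_betw_card_atMost[where 'n='n] j by (auto simp: bij_betw_def inj_on_def)
  then show ?thesis
    using True by (simp add: sym_coord_def symmetrization_def j)
next
  case False
  show ?thesis
  proof (cases "k = 0")
    case False
    with \<open>k \<notin> _\<close> have k: "k > CARD('n)" by auto
    have "card {..i} \<le> CARD('n)" for i :: 'n
      by (simp add: card_mono)
    with k have "{i :: 'n. card {..i} = k} = {}"
      by (auto simp: leD)
    then show ?thesis
      using False k by (simp add: sym_coord_def elem_sym_eq_0)
  qed (simp add: sym_coord_def)
qed

lemma symmetrization_eqI:
  assumes "\<And>k. elem_sym k x = elem_sym k y"
  shows "symmetrization x = symmetrization y"
  using assms by (simp add: symmetrization_def)

text \<open>Expand over the subsets of factors and group them by cardinality. A general commutative
  ring is taken because both complex numbers and formal power series are substituted later.\<close>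

lemma prod_add_const_expansion:
  fixes b :: "'n::finite \<Rightarrow> 'b::comm_ring_1"
  shows "(\<Prod>i\<in>UNIV. a + b i) =
    (\<Sum>k\<le>CARD('n). (\<Sum>A | card A = k. \<Prod>i\<in>A. b i) * a ^ (CARD('n) - k))"
proof -
  have "(\<Prod>i\<in>UNIV. a + b i) = (\<Sum>A\<in>UNIV. (\<Prod>i\<in>A. b i) * a ^ (CARD('n) - card A))"
    by (subst add.commute, subst prod_add) (simp_all add: card_Diff_subset)
  also have "\<dots> = (\<Sum>k\<le>CARD('n). \<Sum>A | A \<in> UNIV \<and> card A = k. (\<Prod>i\<in>A. b i) * a ^ (CARD('n) - card A))"
    by (rule sum.group[symmetric]) (auto simp: card_mono)
  finally show ?thesis
    by (simp add: sum_distrib_right)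
qed

lemma prod_root_expansion:
  fixes x :: "complex ^ 'n::finite"
  shows "(\<Prod>i\<in>UNIV. t - x $ i) =
    (\<Sum>k\<le>CARD('n). (-1) ^ k * elem_sym k x * t ^ (CARD('n) - k))"
proof -
  have "(\<Prod>i\<in>A. - x $ i) = (-1) ^ card A * (\<Prod>i\<in>A. x $ i)" for A
    using prod_uminus[of "\<lambda>i. x $ i" A] by simp
  then show ?thesis
    using prod_add_const_expansion[of t "\<lambda>i. - x $ i"]
    by (simp add: elem_sym_def sum_distrib_left)
qed

text \<open>The monic polynomial whose roots are the entries of any tuple with symmetrization
  \<open>w\<close>. Writing it through the coordinates of \<open>w\<close> makes its dependence on
  \<open>w\<close> affine, which the estimates below exploit.\<close>

definition root_poly :: "complex ^ 'n::{finite,linorder} \<Rightarrow> complex \<Rightarrow> complex" where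
  "root_poly w t = t ^ CARD('n) +
     (\<Sum>i\<in>UNIV. (-1) ^ card {..i} * w $ i * t ^ (CARD('n) - card {..i}))"

lemma root_poly_symmetrization:
  fixes x :: "complex ^ 'n::{finite,linorder}"
  shows "root_poly (symmetrization x) t = (\<Prod>i\<in>UNIV. t - x $ i)"
proof -
  have "(\<Prod>i\<in>UNIV. t - x $ i) =
      t ^ CARD('n) + (\<Sum>k\<in>{1..CARD('n)}. (-1) ^ k * elem_sym k x * t ^ (CARD('n) - k))"
    by (subst prod_root_expansion, subst sum.atMost_shift)
      (simp add: sum.atLeast1_atMost_eq lessThan_Suc_atMost)
  also have "(\<Sum>k\<in>{1..CARD('n)}. (-1) ^ k * elem_sym k x * t ^ (CARD('n) - k)) =
      (\<Sum>i\<in>(UNIV :: 'n set). (-1) ^ card {..i} * elem_sym (card {..i}) x * t ^ (CARD('n) - card {..i}))"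
    by (rule sum.reindex_bij_betw[OF bij_betw_card_atMost, symmetric])
  finally show ?thesis
    by (simp add: root_poly_def symmetrization_def)
qed

section \<open>Newton's identities through formal power series\<close>

text \<open>This is the reversed root polynomial: \<open>elem_sym k\<close> sits at the exponent
  \<open>k\<close> itself, and the vanishing of the coefficients beyond the dimension agrees with
  \<open>elem_sym_eq_0\<close>.\<close>

lemma prod_fps_root_nth:
  fixes x :: "complex ^ 'n::finite"
  shows "fps_nth (\<Prod>i\<in>UNIV. 1 - fps_const (x $ i) * fps_X) k = (-1) ^ k * elem_sym k x"
proof -
  have const_prod: "(\<Prod>i\<in>A. fps_const (f i)) = fps_const (\<Prod>i\<in>A. f i)" for f :: "'n \<Rightarrow> complex" and A
    by (induction A rule: infinite_finite_induct) simp_all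
  have const_sum: "(\<Sum>i\<in>A. fps_const (f i)) = fps_const (\<Sum>i\<in>A. f i)" for f :: "'n set \<Rightarrow> complex" and A
    by (induction A rule: infinite_finite_induct) simp_all
  have *: "(\<Prod>i\<in>A. - (fps_const (x $ i) * fps_X)) =
      fps_const ((-1) ^ card A * (\<Prod>i\<in>A. x $ i)) * fps_X ^ card A" for A
  proof -
    have "(\<Prod>i\<in>A. - (fps_const (x $ i) * fps_X)) = (\<Prod>i\<in>A. fps_const (- x $ i) * fps_X)"
      by (simp flip: fps_const_neg)
    also have "\<dots> = fps_const (\<Prod>i\<in>A. - x $ i) * fps_X ^ card A"
      by (simp add: prod.distrib const_prod del: fps_const_neg)
    also have "(\<Prod>i\<in>A. - x $ i) = (-1) ^ card A * (\<Prod>i\<in>A. x $ i)"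
      using prod_uminus[of "\<lambda>i. x $ i" A] by simp
    finally show ?thesis .
  qed
  have **: "(\<Sum>A | card A = k. \<Prod>i\<in>A. - (fps_const (x $ i) * fps_X)) =
      fps_const ((-1) ^ k * elem_sym k x) * fps_X ^ k" for k
  proof -
    have "(\<Sum>A | card A = k. \<Prod>i\<in>A. - (fps_const (x $ i) * fps_X)) =
        (\<Sum>A | card A = k. fps_const ((-1) ^ k * (\<Prod>i\<in>A. x $ i)) * fps_X ^ k)"
      by (rule sum.cong) (simp_all only: * mem_Collect_eq)
    also have "\<dots> = fps_const (\<Sum>A | card A = k. (-1) ^ k * (\<Prod>i\<in>A. x $ i)) * fps_X ^ k"
      by (simp only: const_sum flip: sum_distrib_right)
    finally show ?thesis
      by (simp only: elem_sym_def sum_distrib_left)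
  qed
  have "(\<Prod>i\<in>UNIV. 1 - fps_const (x $ i) * fps_X) =
      (\<Sum>k\<le>CARD('n). fps_const ((-1) ^ k * elem_sym k x) * fps_X ^ k)"
    using prod_add_const_expansion[of 1 "\<lambda>i. - (fps_const (x $ i) * fps_X)"]
    by (simp add: **)
  then show ?thesis
    by (auto simp: elem_sym_eq_0 fps_sum_nth fps_X_power_nth if_distrib cong: if_cong)
qed

lemma fps_root_geometric: "(1 - fps_const c * fps_X) * Abs_fps (\<lambda>k. c ^ k) = (1 :: complex fps)"
proof (rule fps_ext)
  fix k
  show "fps_nth ((1 - fps_const c * fps_X) * Abs_fps (\<lambda>k. c ^ k)) k = fps_nth (1 :: complex fps) k"
    by (cases k) (simp_all add: left_diff_distrib mult.assoc)
qed

text \<open>The logarithmic derivative of \<open>\<Prod>\<^sub>i (1 - x\<^sub>i X)\<close> with denominators cleared.\<close>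

lemma prod_fps_root_logderiv:
  fixes x :: "'a \<Rightarrow> complex"
  assumes "finite A"
  defines "E \<equiv> \<lambda>A. \<Prod>i\<in>A. 1 - fps_const (x i) * fps_X"
  shows "E A * (\<Sum>i\<in>A. Abs_fps (\<lambda>k. x i ^ k)) = of_nat (card A) * E A - fps_X * fps_deriv (E A)"
  using assms(1)
proof induction
  case empty
  then show ?case by (simp add: E_def)
next
  case (insert a A)
  let ?l = "1 - fps_const (x a) * fps_X" and ?T = "\<lambda>A. \<Sum>i\<in>A. Abs_fps (\<lambda>k. x i ^ k)"
  have E: "E (insert a A) = ?l * E A"
    using insert by (simp add: E_def)
  have d: "fps_deriv (E (insert a A)) = ?l * fps_deriv (E A) - fps_const (x a) * E A"
    by (simp add: E algebra_simps)
  have "E (insert a A) * ?T (insert a A) = E A * (?l * Abs_fps (\<lambda>k. x a ^ k)) + ?l * (E A * ?T A)"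
    using insert by (simp add: E algebra_simps)
  also have "\<dots> = E A + ?l * (of_nat (card A) * E A - fps_X * fps_deriv (E A))"
    by (simp only: fps_root_geometric insert.IH mult_1_right)
  also have "\<dots> = of_nat (card (insert a A)) * E (insert a A) - fps_X * fps_deriv (E (insert a A))"
    unfolding d using insert by (simp add: E algebra_simps)
  finally show ?case .
qed

text \<open>Compare the coefficients of index \<open>k\<close> in
  \<open>prod_fps_root_logderiv\<close>; the term \<open>j = 0\<close> of the Cauchy product is
  \<open>p k\<close>. The formula covers degrees above the dimension too, where
  \<open>elem_sym k x\<close> is 0.\<close>

lemma newton_identity:
  fixes x :: "complex ^ 'n::finite"
  defines "p \<equiv> \<lambda>k. \<Sum>i\<in>UNIV. x $ i ^ k"
  shows "p k = (of_nat CARD('n) - of_nat k) * ((-1) ^ k * elem_sym k x)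
    - (\<Sum>j\<in>{1..k}. (-1) ^ j * elem_sym j x * p (k - j))"
proof -
  define E where "E = (\<Prod>i\<in>UNIV. 1 - fps_const (x $ i) * fps_X)"
  have Ek: "fps_nth E k = (-1) ^ k * elem_sym k x" for k
    by (simp add: E_def prod_fps_root_nth)
  have "fps_nth (E * (\<Sum>i\<in>UNIV. Abs_fps (\<lambda>k. x $ i ^ k))) k
      = fps_nth (of_nat CARD('n) * E - fps_X * fps_deriv E) k"
    using prod_fps_root_logderiv[of UNIV "\<lambda>i. x $ i"] by (simp add: E_def)
  also have "\<dots> = (of_nat CARD('n) - of_nat k) * fps_nth E k"
    by (cases k) (simp_all add: left_diff_distrib fps_mult_of_nat_nth)
  finally have "(\<Sum>j=0..k. fps_nth E j * p (k - j)) = (of_nat CARD('n) - of_nat k) * fps_nth E k"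
    by (simp add: fps_mult_nth fps_sum_nth p_def)
  moreover have "(\<Sum>j=0..k. fps_nth E j * p (k - j)) = p k + (\<Sum>j=1..k. fps_nth E j * p (k - j))"
    by (subst sum.atLeast_Suc_atMost) (simp_all add: Ek)
  ultimately show ?thesis
    by (simp add: Ek algebra_simps)
qed

text \<open>Newton's identity read as a recursion, with the coordinates of \<open>w\<close> in place
  of the elementary symmetric functions: the power sums as polynomials in \<open>w\<close>, with no
  choice of roots.\<close>

function newton :: "complex ^ 'n::{finite,linorder} \<Rightarrow> nat \<Rightarrow> complex" where
  "newton w k = (of_nat CARD('n) - of_nat k) * ((-1) ^ k * sym_coord w k)
    - (\<Sum>j\<in>{1..k}. (-1) ^ j * sym_coord w j * newton w (k - j))"
  by auto
termination
  by (relation "inv_image less_than snd") auto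

declare newton.simps [simp del]

lemma newton_symmetrization: "newton (symmetrization x) k = (\<Sum>i\<in>UNIV. x $ i ^ k)"
proof (induction k rule: less_induct)
  case (less k)
  show ?case
    by (subst newton.simps, subst newton_identity)
      (simp add: sym_coord_symmetrization less.IH)
qed

subsection \<open>Holomorphic functions of the roots\<close>

lemma holomorphic_vec_on_const: "(\<lambda>w. c) holomorphic_vec_on S"
  unfolding holomorphic_vec_on_def by (auto intro!: exI[of _ "\<lambda>_. 0"])

lemma holomorphic_vec_on_component: "(\<lambda>w. w $ i) holomorphic_vec_on S"
  unfolding holomorphic_vec_on_def
  by (auto intro!: exI[of _ "\<lambda>v. v $ i"] bounded_linear_imp_has_derivative)

lemma holomorphic_vec_on_add:
  assumes "f holomorphic_vec_on S" "g holomorphic_vec_on S"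
  shows "(\<lambda>w. f w + g w) holomorphic_vec_on S"
  unfolding holomorphic_vec_on_def
proof
  fix z assume "z \<in> S"
  with assms obtain f' g' where *:
    "(f has_derivative f') (at z within S)" "\<And>c v. f' (c *s v) = c * f' v"
    "(g has_derivative g') (at z within S)" "\<And>c v. g' (c *s v) = c * g' v"
    unfolding holomorphic_vec_on_def by metis
  then show "\<exists>F'. ((\<lambda>w. f w + g w) has_derivative F') (at z within S) \<and> (\<forall>c v. F' (c *s v) = c * F' v)"
    by (intro exI[of _ "\<lambda>v. f' v + g' v"]) (simp add: has_derivative_add distrib_left)
qed

lemma holomorphic_vec_on_mult:
  assumes "f holomorphic_vec_on S" "g holomorphic_vec_on S"
  shows "(\<lambda>w. f w * g w) holomorphic_vec_on S"
  unfolding holomorphic_vec_on_def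
proof
  fix z assume "z \<in> S"
  with assms obtain f' g' where *:
    "(f has_derivative f') (at z within S)" "\<And>c v. f' (c *s v) = c * f' v"
    "(g has_derivative g') (at z within S)" "\<And>c v. g' (c *s v) = c * g' v"
    unfolding holomorphic_vec_on_def by metis
  then show "\<exists>F'. ((\<lambda>w. f w * g w) has_derivative F') (at z within S) \<and> (\<forall>c v. F' (c *s v) = c * F' v)"
    by (intro exI[of _ "\<lambda>v. f z * g' v + f' v * g z"]) (simp add: has_derivative_mult distrib_left mult_ac)
qed

lemma holomorphic_vec_on_sum:
  assumes "\<And>i. i \<in> I \<Longrightarrow> f i holomorphic_vec_on S"
  shows "(\<lambda>w. \<Sum>i\<in>I. f i w) holomorphic_vec_on S"
  using assms
  by (induction I rule: infinite_finite_induct)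
    (simp_all add: holomorphic_vec_on_const holomorphic_vec_on_add)

lemma holomorphic_vec_on_diff:
  assumes "f holomorphic_vec_on S" "g holomorphic_vec_on S"
  shows "(\<lambda>w. f w - g w) holomorphic_vec_on S"
  using holomorphic_vec_on_add[OF assms(1) holomorphic_vec_on_mult[OF holomorphic_vec_on_const assms(2)], of "-1"]
  by simp

lemma holomorphic_vec_on_compose:
  assumes "F holomorphic_vec_on S" "\<phi> holomorphic_on T" "open T" "F ` S \<subseteq> T"
  shows "(\<lambda>w. \<phi> (F w)) holomorphic_vec_on S"
  unfolding holomorphic_vec_on_def
proof
  fix z assume "z \<in> S"
  with assms(1) obtain F' where F':
    "(F has_derivative F') (at z within S)" "\<And>c v. F' (c *s v) = c * F' v"
    unfolding holomorphic_vec_on_def by metis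
  have "(\<phi> has_field_derivative deriv \<phi> (F z)) (at (F z))"
    using assms \<open>z \<in> S\<close> by (intro holomorphic_derivI[of \<phi> T]) auto
  then have "((\<lambda>w. \<phi> (F w)) has_derivative (\<lambda>v. deriv \<phi> (F z) * F' v)) (at z within S)"
    using has_derivative_compose[OF F'(1)] by (simp add: has_field_derivative_def)
  then show "\<exists>F'. ((\<lambda>w. \<phi> (F w)) has_derivative F') (at z within S) \<and> (\<forall>c v. F' (c *s v) = c * F' v)"
    by (intro exI[of _ "\<lambda>v. deriv \<phi> (F z) * F' v"]) (simp add: F'(2) mult_ac)
qed

lemma holomorphic_vec_on_sym_coord: "(\<lambda>w. sym_coord w k) holomorphic_vec_on S"
  unfolding sym_coord_def
  by (cases "k = 0")
    (auto intro: holomorphic_vec_on_const holomorphic_vec_on_sum holomorphic_vec_on_component)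

lemma holomorphic_vec_on_newton:
  "(\<lambda>w. newton w k) holomorphic_vec_on S"
proof (induction k rule: less_induct)
  case (less k)
  then show ?case
    by (subst newton.simps)
      (auto intro!: holomorphic_vec_on_diff holomorphic_vec_on_sum holomorphic_vec_on_mult
         holomorphic_vec_on_const holomorphic_vec_on_sym_coord)
qed

section \<open>Division by the root polynomial, and estimates for roots\<close>

text \<open>One linear factor is split off at a time: the difference quotient of \<open>h\<close> at
  \<open>x a\<close> extends holomorphically over \<open>x a\<close> by the removable singularity in
  \<open>pole_lemma\<close>. Since \<open>A\<close> is a set of indices, repeated roots are
  allowed.\<close>

lemma root_poly_division:
  fixes g :: "complex \<Rightarrow> complex" and x :: "'i \<Rightarrow> complex"
  assumes "finite A" "open D" "g holomorphic_on D" "\<And>i. i \<in> A \<Longrightarrow> x i \<in> D"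
  shows "\<exists>Q h. h holomorphic_on D \<and> (\<forall>t\<in>D. g t = poly Q t + (\<Prod>i\<in>A. t - x i) * h t)"
  using assms(1,4)
proof induction
  case empty
  then show ?case
    using assms(3) by (intro exI[of _ 0] exI[of _ g]) simp
next
  case (insert a A)
  then obtain Q h where Q: "h holomorphic_on D"
      "\<And>t. t \<in> D \<Longrightarrow> g t = poly Q t + (\<Prod>i\<in>A. t - x i) * h t"
    by auto
  define h' where "h' = (\<lambda>t. if t = x a then deriv h (x a) else (h t - h (x a)) / (t - x a))"
  \<comment> \<open>The constant \<open>h (x a)\<close> left over by the new division is still
    multiplied by the old product, so this term is a polynomial and joins \<open>Q\<close>.\<close>
  define Q' where "Q' = Q + smult (h (x a)) (\<Prod>i\<in>A. [:- x i, 1:])"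
  have "h' holomorphic_on D"
    unfolding h'_def using Q(1) insert.prems assms(2) by (intro pole_lemma) (auto simp: interior_open)
  moreover have "g t = poly Q' t + (\<Prod>i\<in>insert a A. t - x i) * h' t" if "t \<in> D" for t
  proof -
    have h: "h t = h (x a) + (t - x a) * h' t"
      by (simp add: h'_def)
    have "g t = poly Q t + (\<Prod>i\<in>A. t - x i) * (h (x a) + (t - x a) * h' t)"
      using Q(2)[OF that] h by simp
    then show ?thesis
      using insert.hyps by (simp add: Q'_def poly_prod algebra_simps)
  qed
  ultimately show ?case by blast
qed

text \<open>A Cauchy type bound: for |t| > 1 every lower power of t is at most |t|^(n-1) in modulus,
  by which the equation is divided. The summand 1 covers |t| <= 1.\<close>

lemma root_bound:
  fixes w :: "complex ^ 'n::{finite,linorder}"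
  assumes "root_poly w t = 0"
  shows "cmod t \<le> 1 + CARD('n) * norm w"
proof (cases "cmod t \<le> 1")
  case False
  let ?n = "CARD('n)"
  have pos: "?n > 0" by simp
  have "t ^ ?n = - (\<Sum>i\<in>UNIV. (-1) ^ card {..i} * w $ i * t ^ (?n - card {..i}))"
    using assms by (simp add: root_poly_def eq_neg_iff_add_eq_0)
  then have "cmod t ^ ?n = cmod (\<Sum>i\<in>UNIV. (-1) ^ card {..i} * w $ i * t ^ (?n - card {..i}))"
    by (metis norm_minus_cancel norm_power)
  also have "\<dots> \<le> (\<Sum>i\<in>(UNIV :: 'n set). norm w * cmod t ^ (?n - 1))"
  proof (intro sum_norm_le)
    fix i :: 'n
    have "card {..i} \<ge> 1"
      by (simp add: Suc_le_eq card_gt_0_iff)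
    then have "cmod t ^ (?n - card {..i}) \<le> cmod t ^ (?n - 1)"
      using False by (intro power_increasing) auto
    then show "cmod ((-1) ^ card {..i} * w $ i * t ^ (?n - card {..i})) \<le> norm w * cmod t ^ (?n - 1)"
      unfolding norm_mult norm_power
      by (intro mult_mono) (auto simp: Finite_Cartesian_Product.norm_nth_le)
  qed
  also have "\<dots> = (?n * norm w) * cmod t ^ (?n - 1)" by simp
  finally have "cmod t * cmod t ^ (?n - 1) \<le> (?n * norm w) * cmod t ^ (?n - 1)"
    using pos by (simp add: power_eq_if[of _ ?n])
  moreover have "cmod t ^ (?n - 1) > 0"
    using False by (intro zero_less_power) linarith
  ultimately have "cmod t \<le> ?n * norm w" by (rule mult_right_le_imp_le)
  then show ?thesis by simp
qed (simp add: add_increasing2)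

text \<open>The leading terms cancel and the rest is linear in \<open>z - w\<close>. At a root
  \<open>t\<close> of \<open>root_poly w\<close> this makes \<open>root_poly z t\<close>
  small.\<close>

lemma root_poly_diff_bound:
  fixes z w :: "complex ^ 'n::{finite,linorder}" and L :: real
  assumes "cmod t \<le> L" "L \<ge> 1"
  shows "cmod (root_poly z t - root_poly w t) \<le> CARD('n) * L ^ CARD('n) * norm (w - z)"
proof -
  let ?n = "CARD('n)"
  have "root_poly z t - root_poly w t =
      (\<Sum>i\<in>UNIV. (-1) ^ card {..i} * (z - w) $ i * t ^ (?n - card {..i}))"
    by (simp add: root_poly_def algebra_simps sum_subtractf)
  also have "cmod \<dots> \<le> (\<Sum>i\<in>(UNIV :: 'n set). norm (w - z) * L ^ ?n)"
  proof (intro sum_norm_le)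
    fix i :: 'n
    have "cmod t ^ (?n - card {..i}) \<le> L ^ (?n - card {..i})"
      using assms by (intro power_mono) auto
    also have "\<dots> \<le> L ^ ?n"
      using assms by (intro power_increasing) auto
    finally have "cmod t ^ (?n - card {..i}) \<le> L ^ ?n" .
    then show "cmod ((-1) ^ card {..i} * (z - w) $ i * t ^ (?n - card {..i})) \<le> norm (w - z) * L ^ ?n"
      unfolding norm_mult norm_power norm_minus_commute[of w z]
      by (intro mult_mono) (auto simp: Finite_Cartesian_Product.norm_nth_le simp del: vector_minus_component)
  qed
  finally show ?thesis by (simp add: mult_ac)
qed

text \<open>The choice \<open>\<rho>\<close> may jump from point to point: the estimates use only
  that each \<open>\<rho> w $ i\<close> is a root of \<open>root_poly w\<close>.\<close>

lemma holomorphic_vec_on_root_sum: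
  fixes \<rho> :: "complex ^ 'n::{finite,linorder} \<Rightarrow> complex ^ 'n::{finite,linorder}"
  assumes "open D" "g holomorphic_on D"
    and \<rho>: "\<And>w. w \<in> S \<Longrightarrow> symmetrization (\<rho> w) = w" "\<And>w i. w \<in> S \<Longrightarrow> \<rho> w $ i \<in> D"
  shows "(\<lambda>w. \<Sum>i\<in>UNIV. g (\<rho> w $ i)) holomorphic_vec_on S"
  unfolding holomorphic_vec_on_def
proof
  fix z assume z: "z \<in> S"
  let ?n = "CARD('n)"
  define P where "P = (\<lambda>t. \<Prod>i\<in>UNIV. t - \<rho> z $ i)"
  have P: "P t = root_poly z t" for t
    using root_poly_symmetrization[of "\<rho> z" t] z \<rho>(1) by (simp add: P_def)
  \<comment> \<open>A single division leaves a remainder of first order in \<open>w - z\<close>, too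
    large to have derivative 0. Dividing the quotient \<open>h1\<close> once more produces the
    square of \<open>P\<close>.\<close>
  obtain Q1 h1 where 1: "h1 holomorphic_on D" "\<And>t. t \<in> D \<Longrightarrow> g t = poly Q1 t + P t * h1 t"
    using root_poly_division[of UNIV D g "\<lambda>i. \<rho> z $ i"] assms(1,2) \<rho>(2)[OF z]
    by (auto simp: P_def)
  obtain Q2 h where 2: "h holomorphic_on D" "\<And>t. t \<in> D \<Longrightarrow> h1 t = poly Q2 t + P t * h t"
    using root_poly_division[of UNIV D h1 "\<lambda>i. \<rho> z $ i"] assms(1) 1(1) \<rho>(2)[OF z]
    by (auto simp: P_def)
  define Q where "Q = Q1 + (\<Prod>i\<in>UNIV. [:- \<rho> z $ i, 1:]) * Q2"
  have g: "g t = poly Q t + (P t)\<^sup>2 * h t" if "t \<in> D" for t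
    using 1(2)[OF that] 2(2)[OF that]
    by (simp add: Q_def P_def poly_prod power2_eq_square algebra_simps)
  define G where "G = (\<lambda>w :: (complex, 'n) vec. \<Sum>k\<le>degree Q. coeff Q k * newton w k)"
  define R where "R = (\<lambda>w. \<Sum>i\<in>UNIV. (P (\<rho> w $ i))\<^sup>2 * h (\<rho> w $ i))"
  have eq: "(\<Sum>i\<in>UNIV. g (\<rho> w $ i)) = G w + R w" if "w \<in> S" for w
  proof -
    have "(\<Sum>i\<in>UNIV. poly Q (\<rho> w $ i)) = (\<Sum>k\<le>degree Q. coeff Q k * newton (symmetrization (\<rho> w)) k)"
      unfolding newton_symmetrization poly_altdef sum_distrib_left by (rule sum.swap)
    then show ?thesis
      using that \<rho> by (simp add: G_def R_def g sum.distrib)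
  qed
  obtain \<epsilon> where \<epsilon>: "\<epsilon> > 0" "\<And>i. cball (\<rho> z $ i) \<epsilon> \<subseteq> D"
  proof -
    have "\<exists>e>0. cball (\<rho> z $ i) e \<subseteq> D" for i
      using assms(1) \<rho>(2)[OF z] by (auto simp: open_contains_cball)
    then obtain e where e: "\<And>i. e i > 0" "\<And>i. cball (\<rho> z $ i) (e i) \<subseteq> D"
      by metis
    show ?thesis
    proof (rule that[of "Min (range e)"])
      show "Min (range e) > 0" using e(1) by (subst Min_gr_iff) auto
      have "Min (range e) \<le> e i" for i by (rule Min_le) auto
      then show "cball (\<rho> z $ i) (Min (range e)) \<subseteq> D" for i
        using e(2)[of i] by (meson order_trans subset_cball)
    qed
  qed
  \<comment> \<open>A compact neighbourhood in \<open>D\<close> of the roots at \<open>z\<close>. It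
    is to contain the roots of all nearby \<open>w\<close>, so that \<open>h\<close> is bounded on
    them.\<close>
  define K where "K = (\<Union>i. cball (\<rho> z $ i) \<epsilon>)"
  have "compact K" "K \<subseteq> D"
    using \<epsilon> by (auto simp: K_def)
  then have "compact (h ` K)"
    using 2(1) by (meson compact_continuous_image holomorphic_on_imp_continuous_on continuous_on_subset)
  then obtain B where B: "B > 0" "\<And>t. t \<in> K \<Longrightarrow> cmod (h t) \<le> B"
    unfolding compact_eq_bounded_closed bounded_pos by auto
  \<comment> \<open>By \<open>root_bound\<close>, \<open>L\<close> bounds the roots of every
    \<open>w\<close> at distance less than 1 from \<open>z\<close>; \<open>C\<close> is then the
    constant of \<open>root_poly_diff_bound\<close>.\<close>
  define L where "L = 1 + ?n * (norm z + 1)"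
  define C where "C = ?n * L ^ ?n"
  have L: "L \<ge> 1" by (simp add: L_def)
  then have C: "C > 0" by (simp add: C_def)
  have root_small: "cmod (P (\<rho> w $ i)) \<le> C * norm (w - z)"
    if "w \<in> S" "norm (w - z) < 1" for w i
  proof -
    have 0: "root_poly w (\<rho> w $ i) = 0"
      using root_poly_symmetrization[of "\<rho> w" "\<rho> w $ i"] \<rho>(1)[OF that(1)] by auto
    have "norm w \<le> norm z + 1"
      using that(2) norm_triangle_sub[of w z] by simp
    then have "real ?n * norm w \<le> ?n * (norm z + 1)"
      by (intro mult_left_mono) auto
    with root_bound[OF 0] have "cmod (\<rho> w $ i) \<le> L"
      unfolding L_def by linarith
    from root_poly_diff_bound[OF this L, of z w] show ?thesis
      by (simp add: P 0 C_def)
  qed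
  \<comment> \<open>A root of \<open>w\<close> outside \<open>K\<close> is at least
    \<open>\<epsilon>\<close> away from each of the n roots at \<open>z\<close>, which forces |P| >=
    \<open>\<epsilon>\<close>^n there. This radius makes \<open>root_small\<close> contradict
    that.\<close>
  define \<delta> where "\<delta> = min 1 (\<epsilon> ^ ?n / C)"
  have \<delta>: "\<delta> > 0" using \<epsilon>(1) C by (simp add: \<delta>_def)
  have root_near: "\<rho> w $ i \<in> K" if "w \<in> S" "norm (w - z) < \<delta>" for w i
  proof (rule ccontr)
    assume "\<rho> w $ i \<notin> K"
    then have "\<epsilon> \<le> cmod (\<rho> w $ i - \<rho> z $ j)" for j
      by (auto simp: K_def dist_norm norm_minus_commute not_le intro: less_imp_le)
    then have "(\<Prod>j\<in>(UNIV :: 'n set). \<epsilon>) \<le> (\<Prod>j\<in>UNIV. cmod (\<rho> w $ i - \<rho> z $ j))"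
      using \<epsilon>(1) by (intro prod_mono) auto
    then have "\<epsilon> ^ ?n \<le> cmod (P (\<rho> w $ i))"
      by (simp add: P_def prod_norm)
    also have "\<dots> \<le> C * norm (w - z)"
      using that by (intro root_small) (auto simp: \<delta>_def)
    also have "\<dots> < \<epsilon> ^ ?n"
      using that(2) C by (simp add: \<delta>_def field_simps)
    finally show False by simp
  qed
  have R_bound: "cmod (R w) \<le> ?n * (C\<^sup>2 * B) * (norm (w - z))\<^sup>2"
    if "w \<in> S" "norm (w - z) < \<delta>" for w
  proof -
    have "cmod (R w) \<le> (\<Sum>i\<in>(UNIV :: 'n set). (C * norm (w - z))\<^sup>2 * B)"
      unfolding R_def
    proof (intro sum_norm_le)
      fix i
      have "cmod (P (\<rho> w $ i)) ^ 2 \<le> (C * norm (w - z)) ^ 2"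
        using that by (intro power_mono root_small) (auto simp: \<delta>_def)
      then show "cmod ((P (\<rho> w $ i))\<^sup>2 * h (\<rho> w $ i)) \<le> (C * norm (w - z))\<^sup>2 * B"
        unfolding norm_mult norm_power by (intro mult_mono B root_near that) auto
    qed
    then show ?thesis by (simp add: power_mult_distrib mult_ac)
  qed
  have "R z = 0"
    using R_bound[OF z] \<delta> by simp
  have "(R has_derivative (\<lambda>v. 0)) (at z within S)"
  proof (rule has_derivativeI_sandwich[OF \<delta>, where H = "\<lambda>w. ?n * (C\<^sup>2 * B) * norm (w - z)"])
    fix w assume w: "w \<in> S" "w \<noteq> z" "dist w z < \<delta>"
    then have "norm (R w - R z - 0) / norm (w - z) \<le> ?n * (C\<^sup>2 * B) * (norm (w - z))\<^sup>2 / norm (w - z)"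
      using R_bound[OF w(1)] \<open>R z = 0\<close> by (intro divide_right_mono) (auto simp: dist_norm)
    then show "norm (R w - R z - 0) / norm (w - z) \<le> ?n * (C\<^sup>2 * B) * norm (w - z)"
      using w(2) by (simp add: power2_eq_square mult_ac)
  next
    show "((\<lambda>w. ?n * (C\<^sup>2 * B) * norm (w - z)) \<longlongrightarrow> 0) (at z within S)"
      by (rule tendsto_eq_intros refl | simp)+
  qed simp
  moreover have "G holomorphic_vec_on S"
    unfolding G_def by (intro holomorphic_vec_on_sum holomorphic_vec_on_mult
        holomorphic_vec_on_const holomorphic_vec_on_newton)
  then obtain G' where G': "(G has_derivative G') (at z within S)" "\<And>c v. G' (c *s v) = c * G' v"
    using z unfolding holomorphic_vec_on_def by metis
  ultimately have "((\<lambda>w. G w + R w) has_derivative (\<lambda>v. G' v + 0)) (at z within S)"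
    by (intro has_derivative_add)
  then have "((\<lambda>w. \<Sum>i\<in>UNIV. g (\<rho> w $ i)) has_derivative G') (at z within S)"
    using z eq by (auto intro: has_derivative_transform)
  with G'(2) show "\<exists>F'. ((\<lambda>w. \<Sum>i\<in>UNIV. g (\<rho> w $ i)) has_derivative F') (at z within S) \<and>
      (\<forall>c v. F' (c *s v) = c * F' v)"
    by blast
qed

subsection \<open>Hyperbolicity of the symmetric product\<close>

lemma disc_maps_mult:
  assumes "f \<in> disc_maps D" "g \<in> disc_maps D"
  shows "(\<lambda>z. f z * g z) \<in> disc_maps D"
proof -
  have "cmod (f z * g z) < 1" if "z \<in> D" for z
    using assms that mult_strict_mono'[of "cmod (f z)" 1 "cmod (g z)" 1]
    by (auto simp: disc_maps_def norm_mult image_subset_iff)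
  then show ?thesis
    using assms by (auto simp: disc_maps_def image_subset_iff intro: holomorphic_on_mult)
qed

lemma less_caratheodory_dist:
  "ereal M < caratheodory_dist \<O> \<Omega> w z \<longleftrightarrow> (\<exists>F\<in>\<O> \<Omega>. F w = 0 \<and> M < artanh (cmod (F z)))"
  by (auto simp: caratheodory_dist_def less_SUP_iff poincare_dist_def)

lemma artanh_pos_iff:
  fixes x :: real
  assumes "0 \<le> x" "x < 1"
  shows "0 < artanh x \<longleftrightarrow> x > 0"
  using assms by (auto simp: artanh_def ln_gt_zero_iff)

text \<open>Since \<open>artanh\<close> is positive exactly on positive arguments, hyperbolicity
  turns into separation of points by disc maps, with no quantitative content.\<close>

lemma caratheodory_dist_pos_iff:
  assumes "\<And>F. F \<in> \<O> \<Omega> \<Longrightarrow> F ` \<Omega> \<subseteq> ball 0 1" "z \<in> \<Omega>"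
  shows "0 < caratheodory_dist \<O> \<Omega> w z \<longleftrightarrow> (\<exists>F\<in>\<O> \<Omega>. F w = 0 \<and> F z \<noteq> 0)"
proof -
  have "0 < artanh (cmod (F z)) \<longleftrightarrow> F z \<noteq> 0" if "F \<in> \<O> \<Omega>" for F
    using assms(1)[OF that] assms(2) by (subst artanh_pos_iff) auto
  then show ?thesis
    using less_caratheodory_dist[of 0 \<O> \<Omega> w z] by (auto simp: zero_ereal_def)
qed

lemma caratheodory_hyperbolic_disc_maps_iff:
  "caratheodory_hyperbolic disc_maps D \<longleftrightarrow>
    (\<forall>w\<in>D. \<forall>z\<in>D. w \<noteq> z \<longrightarrow> (\<exists>F\<in>disc_maps D. F w = 0 \<and> F z \<noteq> 0))"
proof -
  have "0 < caratheodory_dist disc_maps D w z \<longleftrightarrow> (\<exists>F\<in>disc_maps D. F w = 0 \<and> F z \<noteq> 0)"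
    if "z \<in> D" for w z
    using that by (intro caratheodory_dist_pos_iff) (auto simp: disc_maps_def)
  then show ?thesis
    by (simp add: caratheodory_hyperbolic_def)
qed

lemma caratheodory_hyperbolic_disc_maps_vec_iff:
  "caratheodory_hyperbolic disc_maps_vec S \<longleftrightarrow>
    (\<forall>w\<in>S. \<forall>z\<in>S. w \<noteq> z \<longrightarrow> (\<exists>F\<in>disc_maps_vec S. F w = 0 \<and> F z \<noteq> 0))"
proof -
  have "0 < caratheodory_dist disc_maps_vec S w z \<longleftrightarrow> (\<exists>F\<in>disc_maps_vec S. F w = 0 \<and> F z \<noteq> 0)"
    if "z \<in> S" for w z
    using that by (intro caratheodory_dist_pos_iff) (auto simp: disc_maps_vec_def)
  then show ?thesis
    by (simp add: caratheodory_hyperbolic_def)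
qed

section \<open>Choosing roots, and separating points of the symmetric product\<close>

text \<open>An arbitrary choice of an ordered root tuple, with no continuity claimed and meaningful
  only for \<open>w\<close> in \<open>sym_product D\<close>. Symmetric sums over it are well behaved
  by \<open>holomorphic_vec_on_root_sum\<close>.\<close>

definition roots_in :: "complex set \<Rightarrow> complex ^ 'n::{finite,linorder} \<Rightarrow> complex ^ 'n::{finite,linorder}" where
  "roots_in D w = (SOME x. (\<forall>i. x $ i \<in> D) \<and> symmetrization x = w)"

lemma roots_in:
  assumes "w \<in> sym_product D"
  shows "roots_in D w $ i \<in> D" "symmetrization (roots_in D w) = w"
proof -
  have "\<exists>x. (\<forall>i. x $ i \<in> D) \<and> symmetrization x = w"
    using assms by (auto simp: sym_product_def)
  from someI_ex[OF this] show "roots_in D w $ i \<in> D" "symmetrization (roots_in D w) = w"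
    by (auto simp: roots_in_def)
qed

lemma sym_productI: "(\<And>i. x $ i \<in> D) \<Longrightarrow> symmetrization x \<in> sym_product D"
  by (auto simp: sym_product_def)

lemma holomorphic_vec_on_sym_product_sum:
  assumes "open D" "g holomorphic_on D"
  shows "(\<lambda>w. \<Sum>i\<in>UNIV. g (roots_in D w $ i)) holomorphic_vec_on sym_product D"
  using assms by (intro holomorphic_vec_on_root_sum[where D = D]) (auto simp: roots_in)

text \<open>The product of the factors \<open>1 - fps_const t * fps_X\<close> depends only on the
  multiset of roots, and its coefficients are the elementary symmetric functions up to sign.\<close>

lemma symmetrization_eq_if_multiplicities_eq:
  fixes x y :: "complex ^ 'n::{finite,linorder}"
  assumes "\<And>a. card {i. x $ i = a} = card {i. y $ i = a}"
  shows "symmetrization x = symmetrization y"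
proof (rule symmetrization_eqI)
  fix k
  have "image_mset (\<lambda>i. x $ i) (mset_set UNIV) = image_mset (\<lambda>i. y $ i) (mset_set UNIV)"
    using assms by (intro multiset_eqI) (simp add: count_image_mset vimage_def)
  then have "image_mset (\<lambda>t. 1 - fps_const t * fps_X) (image_mset (\<lambda>i. x $ i) (mset_set UNIV)) =
      image_mset (\<lambda>t. 1 - fps_const t * fps_X) (image_mset (\<lambda>i. y $ i) (mset_set UNIV))"
    by simp
  then have "(\<Prod>i\<in>UNIV. 1 - fps_const (x $ i) * fps_X) = (\<Prod>i\<in>UNIV. 1 - fps_const (y $ i) * fps_X)"
    unfolding prod_unfold_prod_mset by (simp add: image_mset.compositionality o_def)
  then have "(-1) ^ k * elem_sym k x = (-1) ^ k * elem_sym k y"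
    by (metis prod_fps_root_nth)
  then show "elem_sym k x = elem_sym k y" by simp
qed

text \<open>Start with the constant 1/2 and multiply, for each \<open>b\<close> in \<open>A\<close>,
  by a disc map that vanishes at \<open>b\<close> but not at \<open>a\<close>.\<close>

lemma disc_maps_peak:
  assumes "caratheodory_hyperbolic disc_maps D" "finite A" "A \<subseteq> D" "a \<in> D" "a \<notin> A"
  shows "\<exists>f\<in>disc_maps D. f a \<noteq> 0 \<and> (\<forall>b\<in>A. f b = 0)"
  using assms(2,3,5)
proof induction
  case empty
  have "(\<lambda>_. 1/2) \<in> disc_maps D"
    by (auto simp: disc_maps_def)
  then show ?case by (intro bexI[of _ "\<lambda>_. 1/2"]) auto
next
  case (insert b A)
  then obtain f where f: "f \<in> disc_maps D" "f a \<noteq> 0" "\<forall>b\<in>A. f b = 0"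
    by auto
  obtain g where g: "g \<in> disc_maps D" "g b = 0" "g a \<noteq> 0"
    using insert.prems assms(1,4) unfolding caratheodory_hyperbolic_disc_maps_iff by fastforce
  show ?case
    using f g by (intro bexI[of _ "\<lambda>z. f z * g z"] disc_maps_mult) auto
qed

lemma caratheodory_hyperbolic_sym_product:
  assumes "open D" and hyp: "caratheodory_hyperbolic disc_maps D"
  shows "caratheodory_hyperbolic disc_maps_vec (sym_product D :: (complex ^ 'n::{finite,linorder}) set)"
  unfolding caratheodory_hyperbolic_disc_maps_vec_iff
proof (intro ballI impI)
  fix w z :: "(complex, 'n) vec"
  assume w: "w \<in> sym_product D" and z: "z \<in> sym_product D" and "w \<noteq> z"
  let ?x = "roots_in D w" and ?y = "roots_in D z" and ?n = "CARD('n)"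
  obtain a where a: "card {i. ?x $ i = a} \<noteq> card {i. ?y $ i = a}"
    using symmetrization_eq_if_multiplicities_eq[of ?x ?y] roots_in(2)[OF w] roots_in(2)[OF z] \<open>w \<noteq> z\<close>
    by metis
  define A where "A = range (\<lambda>i. ?x $ i) \<union> range (\<lambda>i. ?y $ i)"
  have "A \<subseteq> D" "finite A"
    using roots_in(1)[OF w] roots_in(1)[OF z] by (auto simp: A_def)
  have "a \<in> A"
  proof (rule ccontr)
    assume "a \<notin> A"
    then have "{i. ?x $ i = a} = {}" "{i. ?y $ i = a} = {}"
      by (auto simp: A_def)
    with a show False by simp
  qed
  obtain g where g: "g \<in> disc_maps D" "g a \<noteq> 0" "\<And>b. b \<in> A - {a} \<Longrightarrow> g b = 0"
    using disc_maps_peak[OF hyp, of "A - {a}" a] \<open>A \<subseteq> D\<close> \<open>finite A\<close> \<open>a \<in> A\<close> by auto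
  define G where "G = (\<lambda>w :: (complex, 'n) vec. \<Sum>i\<in>UNIV. g (roots_in D w $ i))"
  \<comment> \<open>On \<open>A\<close> the function \<open>g\<close> lives only at
    \<open>a\<close>, so the sum counts the multiplicity of \<open>a\<close>, which differs for
    \<open>w\<close> and \<open>z\<close>.\<close>
  have sum_g: "(\<Sum>i\<in>UNIV. g (x $ i)) = of_nat (card {i. x $ i = a}) * g a"
    if "range (\<lambda>i. x $ i) \<subseteq> A" for x :: "(complex, 'n) vec"
  proof -
    have "(\<Sum>i\<in>UNIV. g (x $ i)) = (\<Sum>i\<in>UNIV. if x $ i = a then g a else 0)"
      using that g(3) by (intro sum.cong) auto
    then show ?thesis by (simp flip: sum.inter_filter)
  qed
  have "G w \<noteq> G z"
    using a g(2) by (simp add: G_def sum_g A_def)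
  have G_bound: "cmod (G v) \<le> ?n" if "v \<in> sym_product D" for v
  proof -
    have "cmod (G v) \<le> (\<Sum>i\<in>(UNIV :: 'n set). 1)"
      unfolding G_def using g(1) roots_in(1)[OF that]
      by (intro sum_norm_le) (auto simp: disc_maps_def image_subset_iff intro: less_imp_le)
    then show ?thesis by simp
  qed
  \<comment> \<open>\<open>G\<close> is bounded by n, hence the difference by 2n; the extra 1 in the
    denominator makes the bound by 1 strict.\<close>
  define F where "F = (\<lambda>v. 1 / (2 * of_nat ?n + 1) * (G v - G w))"
  have "F holomorphic_vec_on sym_product D"
    unfolding F_def G_def using assms(1) g(1)
    by (intro holomorphic_vec_on_mult holomorphic_vec_on_diff holomorphic_vec_on_const
        holomorphic_vec_on_sym_product_sum) (auto simp: disc_maps_def)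
  moreover have "cmod (F v) < 1" if "v \<in> sym_product D" for v
  proof -
    have "cmod (G v - G w) \<le> 2 * ?n"
      using norm_triangle_ineq4[of "G v" "G w"] G_bound[OF that] G_bound[OF w] by linarith
    moreover have "cmod (2 * of_nat ?n + 1) = 2 * real ?n + 1"
      using norm_of_nat[of "2 * ?n + 1", where 'a = complex] by (simp add: add.commute)
    ultimately show ?thesis
      by (simp add: F_def norm_divide divide_less_eq)
  qed
  ultimately have "F \<in> disc_maps_vec (sym_product D)"
    by (auto simp: disc_maps_vec_def)
  moreover have "2 * of_nat ?n + 1 \<noteq> (0 :: complex)"
    using of_nat_neq_0[of "2 * ?n", where 'a = complex] by (simp add: add.commute)
  then have "F w = 0" "F z \<noteq> 0"
    using \<open>G w \<noteq> G z\<close> by (auto simp: F_def)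
  ultimately show "\<exists>F\<in>disc_maps_vec (sym_product D). F w = 0 \<and> F z \<noteq> 0"
    by blast
qed

subsection \<open>Finite compactness of the symmetric product\<close>

text \<open>Finiteness of the Caratheodory distance on a domain, by normal families and the maximum principle.\<close>

lemma disc_maps_uniform_bound:
  assumes "is_domain D" "a \<in> D" "b \<in> D"
  shows "\<exists>r<1. \<forall>f\<in>disc_maps D. f a = 0 \<longrightarrow> cmod (f b) \<le> r"
proof (rule ccontr)
  assume "\<not> ?thesis"
  then have "\<exists>f. f \<in> disc_maps D \<and> f a = 0 \<and> cmod (f b) > 1 - 1 / real (Suc n)" for n
    by (smt (verit) divide_pos_pos of_nat_0_less_iff zero_less_Suc)
  then obtain f where f: "\<And>n. f n \<in> disc_maps D" "\<And>n. f n a = 0"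
      "\<And>n. cmod (f n b) > 1 - 1 / real (Suc n)"
    by metis
  have D: "open D" "connected D"
    using assms(1) by (auto simp: is_domain_def)
  obtain g r where g: "g holomorphic_on D" "strict_mono (r :: nat \<Rightarrow> nat)"
      "\<And>x. x \<in> D \<Longrightarrow> (\<lambda>n. f (r n) x) \<longlonglongrightarrow> g x"
  proof (rule Montel[of D "disc_maps D" f])
    show "\<exists>B. \<forall>h\<in>disc_maps D. \<forall>z\<in>K. cmod (h z) \<le> B" if "K \<subseteq> D" for K
      using that by (intro exI[of _ 1]) (force simp: disc_maps_def)
  qed (use f D in \<open>auto simp: disc_maps_def image_subset_iff\<close>)
  have le: "cmod (g x) \<le> 1" if "x \<in> D" for x
    by (rule LIMSEQ_le_const2[OF tendsto_norm[OF g(3)[OF that]]])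
      (use f(1) that in \<open>auto simp: disc_maps_def image_subset_iff intro!: exI[of _ 0] less_imp_le\<close>)
  have "(\<lambda>n. 1 - 1 / real (Suc (r n))) \<longlonglongrightarrow> 1 - 0"
    using LIMSEQ_subseq_LIMSEQ[OF LIMSEQ_inverse_real_of_nat g(2)]
    by (intro tendsto_intros) (simp add: o_def inverse_eq_divide)
  then have "1 \<le> cmod (g b)"
    using LIMSEQ_le[OF _ tendsto_norm[OF g(3)[OF assms(3)]]] f(3) by (simp add: less_imp_le)
  \<comment> \<open>The limit \<open>g\<close> reaches its maximal modulus 1 at the interior point
    \<open>b\<close>, so it is constant; but \<open>g a = 0\<close>.\<close>
  with le assms(3) have "g constant_on D"
    by (intro maximum_modulus_principle[OF g(1) D D(1) order_refl assms(3)]) (use order_trans in blast)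
  moreover have "g a = 0"
    using g(3)[OF assms(2)] by (simp add: f(2) LIMSEQ_const_iff)
  ultimately show False
    using assms(2,3) \<open>1 \<le> cmod (g b)\<close> by (auto simp: constant_on_def)
qed

text \<open>Here \<open>q\<close> is the image of \<open>u\<close> under the Moebius map from the
  right half plane to the disc that sends \<open>v\<close> to 0. The bound rests on 1 - |q|^2 = 4 Re
  u Re v / |u + cnj v|^2 and says that a large \<open>Re u\<close> is far from
  \<open>v\<close>.\<close>

lemma half_plane_to_disc:
  assumes "Re u > 0" "Re v > 0"
  defines "q \<equiv> (u - v) / (u + cnj v)"
  shows "cmod q < 1" "(1 + cmod q) / (1 - cmod q) \<ge> Re u / (4 * cmod v)"
proof -
  let ?m = "cmod (u + cnj v)"
  have ge: "?m \<ge> Re u + Re v"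
    using complex_Re_le_cmod[of "u + cnj v"] by simp
  with assms(1,2) have m: "?m > 0" by linarith
  have "?m\<^sup>2 - (cmod (u - v))\<^sup>2 = 4 * Re u * Re v"
    by (simp add: cmod_power2) (simp add: power2_eq_square algebra_simps)
  moreover have "1 - (cmod q)\<^sup>2 = (?m\<^sup>2 - (cmod (u - v))\<^sup>2) / ?m\<^sup>2"
    unfolding q_def norm_divide power_divide using m by (simp add: diff_divide_distrib[of "?m\<^sup>2"])
  ultimately have eq: "1 - (cmod q)\<^sup>2 = 4 * Re u * Re v / ?m\<^sup>2"
    by simp
  also have "\<dots> > 0"
    using m assms by simp
  finally have pos: "1 - (cmod q)\<^sup>2 > 0" .
  then show lt: "cmod q < 1"
    by (simp add: power_less_one_iff abs_square_less_1)
  have "1 - (cmod q)\<^sup>2 \<le> 4 * Re u * Re v / (Re u)\<^sup>2"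
    unfolding eq using assms m ge by (intro divide_left_mono power_mono mult_pos_pos) auto
  also have "\<dots> = 4 * Re v / Re u"
    using assms by (simp add: power2_eq_square)
  also have "\<dots> \<le> 4 * cmod v / Re u"
    using assms complex_Re_le_cmod[of v] by (intro divide_right_mono) auto
  finally have "1 - (cmod q)\<^sup>2 \<le> 4 * cmod v / Re u" .
  then have "1 / (4 * cmod v / Re u) \<le> 1 / (1 - (cmod q)\<^sup>2)"
    using pos by (intro divide_left_mono mult_pos_pos) auto
  \<comment> \<open>Enlarging the numerator from 1 to (1 + |q|)^2 lets the factor 1 + |q| of the
    denominator cancel.\<close>
  also have "\<dots> \<le> (1 + cmod q)\<^sup>2 / (1 - (cmod q)\<^sup>2)"
    using pos by (intro divide_right_mono) (auto simp: one_le_power)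
  also have "\<dots> = (1 + cmod q) / (1 - cmod q)"
  proof -
    have "1 - (cmod q)\<^sup>2 = (1 + cmod q) * (1 - cmod q)"
      by (simp add: power2_eq_square algebra_simps)
    moreover have "1 + cmod q > 0"
      by (simp add: add_pos_nonneg)
    ultimately show ?thesis
      by (simp add: power2_eq_square)
  qed
  finally show "(1 + cmod q) / (1 - cmod q) \<ge> Re u / (4 * cmod v)"
    by simp
qed

lemma Re_cayley_pos:
  assumes "cmod z < 1"
  shows "Re ((1 + z) / (1 - z)) > 0"
proof -
  have "z \<noteq> 1" using assms by auto
  then have "cmod (1 - z) > 0" by simp
  have "Re ((1 + z) / (1 - z)) = (1 - (cmod z)\<^sup>2) / (cmod (1 - z))\<^sup>2"
    by (simp add: Re_divide cmod_power2) (simp add: power2_eq_square algebra_simps)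
  also have "\<dots> > 0"
    using assms \<open>cmod (1 - z) > 0\<close> by (simp add: power_less_one_iff abs_square_less_1)
  finally show ?thesis .
qed

text \<open>The quotient is exp (2 artanh x), and it is also the value of the Cayley transform at
  \<open>x\<close>, so distances can be compared through real parts in the half plane.\<close>

lemma less_artanh_iff:
  fixes x :: real
  assumes "0 \<le> x" "x < 1"
  shows "M < artanh x \<longleftrightarrow> exp (2 * M) < (1 + x) / (1 - x)"
proof -
  have "exp (2 * artanh x) = (1 + x) / (1 - x)"
    using assms by (simp add: artanh_def)
  then show ?thesis
    by (metis exp_less_cancel_iff mult_less_cancel_left_pos zero_less_numeral)
qed

text \<open>One far root suffices because the Cayley transforms at the other roots have positive
  real part and cannot cancel its contribution. The threshold \<open>M\<close> comes from the roots
  of \<open>w0\<close> alone, hence is uniform in \<open>w\<close> and \<open>j\<close>.\<close>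

lemma caratheodory_dist_sym_product_large:
  fixes w0 :: "complex ^ 'n::{finite,linorder}"
  assumes "is_domain D" "a \<in> D" "w0 \<in> sym_product D"
  shows "\<exists>M. \<forall>w\<in>sym_product D. \<forall>j. ereal M < caratheodory_dist disc_maps D a (roots_in D w $ j) \<longrightarrow>
    ereal R < caratheodory_dist disc_maps_vec (sym_product D) w0 w"
proof -
  let ?n = "CARD('n)"
  have "open D" using assms(1) by (simp add: is_domain_def)
  obtain r where r: "\<And>i. r i < 1"
      "\<And>i f. f \<in> disc_maps D \<Longrightarrow> f a = 0 \<Longrightarrow> cmod (f (roots_in D w0 $ i)) \<le> r i"
    using disc_maps_uniform_bound[OF assms(1,2) roots_in(1)[OF assms(3)]] by metis
  \<comment> \<open>Each summand bounds |(1 + f) / (1 - f)| at one root of \<open>w0\<close>, so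
    \<open>T\<close> bounds \<open>H w0\<close> for whatever disc map is used below.\<close>
  define T where "T = (\<Sum>i\<in>UNIV. 2 / (1 - r i))"
  have "T > 0"
    unfolding T_def using r(1) by (intro sum_pos) auto
  \<comment> \<open>Chosen so that exp (2M) = 4 T exp (2R), which absorbs the factor 4 |v| lost in
    \<open>half_plane_to_disc\<close> with v = \<open>H w0\<close>.\<close>
  define M where "M = R + ln (4 * T) / 2"
  have exp_M: "exp (2 * M) = 4 * T * exp (2 * R)"
    using \<open>T > 0\<close> by (simp add: M_def distrib_left exp_add)
  have "ereal R < caratheodory_dist disc_maps_vec (sym_product D) w0 w"
    if w: "w \<in> sym_product D" and M: "ereal M < caratheodory_dist disc_maps D a (roots_in D w $ j)" for w j
  proof -
    let ?b = "roots_in D w $ j"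
    obtain f0 where f0: "f0 \<in> disc_maps D" "f0 a = 0" "M < artanh (cmod (f0 ?b))"
      using M by (auto simp: less_caratheodory_dist)
    \<comment> \<open>A rotation makes the value at \<open>?b\<close> real and nonnegative, so that
      its Cayley transform is exactly (1 + |f0|) / (1 - |f0|) there.\<close>
    obtain c where c: "cmod c = 1" "c * f0 ?b = cmod (f0 ?b)"
    proof (cases "f0 ?b = 0")
      case False
      then show ?thesis
        by (intro that[of "cmod (f0 ?b) / f0 ?b"]) (auto simp: norm_divide)
    qed (use that[of 1] in auto)
    define f where "f = (\<lambda>t. c * f0 t)"
    have f: "f \<in> disc_maps D" "f a = 0" "f ?b = of_real (cmod (f0 ?b))"
      using f0 c by (auto simp: f_def disc_maps_def norm_mult image_subset_iff intro!: holomorphic_intros)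
    have f_lt: "cmod (f t) < 1" if "t \<in> D" for t
      using f(1) that by (auto simp: disc_maps_def)
    define h where "h = (\<lambda>t. (1 + f t) / (1 - f t))"
    have "h holomorphic_on D"
      unfolding h_def using f(1) f_lt
      by (intro holomorphic_intros) (auto simp: disc_maps_def)
    have Re_h: "Re (h t) > 0" if "t \<in> D" for t
      unfolding h_def by (rule Re_cayley_pos[OF f_lt[OF that]])
    define H where "H = (\<lambda>v :: (complex, 'n) vec. \<Sum>i\<in>UNIV. h (roots_in D v $ i))"
    have Re_H: "Re (H v) > 0" if "v \<in> sym_product D" for v
      unfolding H_def Re_sum using roots_in(1)[OF that] by (intro sum_pos Re_h) auto
    have "cmod (H w0) \<le> T"
      unfolding H_def T_def
    proof (intro sum_norm_le)
      fix i
      let ?t = "roots_in D w0 $ i"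
      have "cmod (f ?t) \<le> r i" by (intro r(2) f)
      moreover have "cmod (1 - f ?t) \<ge> 1 - cmod (f ?t)" "cmod (1 + f ?t) \<le> 1 + cmod (f ?t)"
        using norm_triangle_ineq2[of 1 "f ?t"] norm_triangle_ineq[of 1 "f ?t"] by simp_all
      ultimately show "cmod (h ?t) \<le> 2 / (1 - r i)"
        unfolding h_def norm_divide using r(1)[of i] by (intro frac_le) auto
    qed
    define F where "F = (\<lambda>v. (H v - H w0) / (H v + cnj (H w0)))"
    have "F holomorphic_vec_on sym_product D"
      unfolding F_def
    proof (rule holomorphic_vec_on_compose[where F = H and T = "{s. Re s > 0}"
          and \<phi> = "\<lambda>s. (s - H w0) / (s + cnj (H w0))"])
      show "H holomorphic_vec_on sym_product D"
        unfolding H_def by (intro holomorphic_vec_on_sym_product_sum) fact+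
      have "s + cnj (H w0) \<noteq> 0" if "Re s > 0" for s
      proof -
        have "Re (s + cnj (H w0)) > 0" using that Re_H[OF assms(3)] by simp
        then show ?thesis by (metis less_irrefl zero_complex.sel(1))
      qed
      then show "(\<lambda>s. (s - H w0) / (s + cnj (H w0))) holomorphic_on {s. Re s > 0}"
        by (intro holomorphic_intros) auto
    qed (auto simp: open_halfspace_Re_gt Re_H)
    moreover have "cmod (F v) < 1" if "v \<in> sym_product D" for v
      unfolding F_def by (intro half_plane_to_disc Re_H that assms)
    ultimately have F: "F \<in> disc_maps_vec (sym_product D)"
      by (auto simp: disc_maps_vec_def)
    have b: "?b \<in> D" using w by (rule roots_in)
    have "exp (2 * M) < (1 + cmod (f0 ?b)) / (1 - cmod (f0 ?b))"
      using f0(3) f_lt[OF b] by (subst less_artanh_iff[symmetric]) (auto simp: f(3))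
    also have "\<dots> = Re (h ?b)"
    proof -
      have "h ?b = of_real ((1 + cmod (f0 ?b)) / (1 - cmod (f0 ?b)))"
        by (simp add: h_def f(3))
      then show ?thesis by (simp only: Re_complex_of_real)
    qed
    also have "\<dots> \<le> Re (H w)"
      unfolding H_def Re_sum using roots_in(1)[OF w]
      by (intro member_le_sum) (auto intro: less_imp_le Re_h)
    finally have "4 * T * exp (2 * R) < Re (H w)" by (simp only: exp_M)
    moreover have "H w0 \<noteq> 0" using Re_H[OF assms(3)] by auto
    moreover have "4 * cmod (H w0) * exp (2 * R) \<le> 4 * T * exp (2 * R)"
      using \<open>cmod (H w0) \<le> T\<close> by simp
    ultimately have "4 * cmod (H w0) * exp (2 * R) < Re (H w)" "4 * cmod (H w0) > 0"
      by (linarith, simp)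
    then have "exp (2 * R) < Re (H w) / (4 * cmod (H w0))"
      by (subst pos_less_divide_eq) (simp_all add: mult_ac)
    also have "\<dots> \<le> (1 + cmod (F w)) / (1 - cmod (F w))"
      unfolding F_def by (intro half_plane_to_disc Re_H w assms)
    finally have "R < artanh (cmod (F w))"
      using w F by (subst less_artanh_iff) (auto simp: disc_maps_vec_def)
    moreover have "F w0 = 0" by (simp add: F_def)
    ultimately show ?thesis
      using F by (auto simp: less_caratheodory_dist)
  qed
  then show ?thesis by blast
qed

section \<open>Extracting convergent subsequences\<close>

text \<open>The definition measures distances from the first term of a sequence, so \<open>a\<close>
  is put in front of \<open>f\<close> and the contrapositive is applied.\<close>

lemma c_finitely_compact_convergent_subseq:
  assumes "c_finitely_compact disc_maps D" "a \<in> D" "\<And>k. f k \<in> D"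
    and bound: "\<And>k. \<not> ereal M < caratheodory_dist disc_maps D a (f k)"
  shows "\<exists>l\<in>D. \<exists>r. strict_mono (r :: nat \<Rightarrow> nat) \<and> (\<lambda>k. f (r k)) \<longlonglongrightarrow> l"
proof -
  define z where "z = case_nat a f"
  have "range z \<subseteq> D"
    using assms(2,3) by (auto simp: z_def split: nat.split)
  moreover have "\<not> (\<lambda>k. caratheodory_dist disc_maps D (z 0) (z k)) \<longlonglongrightarrow> \<infinity>"
  proof
    assume "(\<lambda>k. caratheodory_dist disc_maps D (z 0) (z k)) \<longlonglongrightarrow> \<infinity>"
    then have "eventually (\<lambda>k. ereal M < caratheodory_dist disc_maps D (z 0) (z k)) sequentially"
      by (simp add: tendsto_PInfty)
    then obtain k where "ereal M < caratheodory_dist disc_maps D (z 0) (z (Suc k))"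
      by (meson eventually_sequentially le_SucI order_refl)
    with bound show False by (simp add: z_def)
  qed
  ultimately obtain l r where r: "l \<in> D" "strict_mono r" "(z \<circ> r) \<longlonglongrightarrow> l"
    using assms(1) unfolding c_finitely_compact_def by blast
  \<comment> \<open>The shift by 1 removes the prepended \<open>a\<close>. Starting at
    \<open>r (Suc k)\<close> keeps the index positive, so the natural subtraction is exact.\<close>
  define s where "s = (\<lambda>k. r (Suc k) - 1)"
  have pos: "r (Suc k) > 0" for k
    using strict_monoD[OF r(2), of k "Suc k"] by simp
  have "strict_mono s"
    unfolding strict_mono_Suc_iff s_def
  proof
    fix k
    show "r (Suc k) - 1 < r (Suc (Suc k)) - 1"
      using strict_monoD[OF r(2), of "Suc k" "Suc (Suc k)"] pos[of k] by simp
  qed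
  moreover have "f (s k) = z (r (Suc k))" for k
    using pos[of k] by (simp add: z_def s_def split: nat.split)
  then have "(\<lambda>k. f (s k)) \<longlonglongrightarrow> l"
    using LIMSEQ_Suc[OF r(3)] by simp
  ultimately show ?thesis
    using r(1) by blast
qed

text \<open>Indices are treated one at a time, each thinning the previous subsequence; therefore the
  assumption is made along every subsequence \<open>s\<close>.\<close>

lemma common_convergent_subseq:
  fixes x :: "nat \<Rightarrow> 'i \<Rightarrow> 'a::topological_space"
  assumes "finite I"
    and subseq: "\<And>i s. i \<in> I \<Longrightarrow> strict_mono (s :: nat \<Rightarrow> nat) \<Longrightarrow>
      \<exists>l\<in>D. \<exists>r. strict_mono (r :: nat \<Rightarrow> nat) \<and> (\<lambda>k. x (s (r k)) i) \<longlonglongrightarrow> l"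
  shows "\<exists>l r. strict_mono (r :: nat \<Rightarrow> nat) \<and> (\<forall>i\<in>I. l i \<in> D \<and> (\<lambda>k. x (r k) i) \<longlonglongrightarrow> l i)"
  using assms
proof induction
  case empty
  then show ?case by (auto intro: strict_mono_id)
next
  case (insert j I)
  then obtain l s where s: "strict_mono s" "\<And>i. i \<in> I \<Longrightarrow> l i \<in> D"
      "\<And>i. i \<in> I \<Longrightarrow> (\<lambda>k. x (s k) i) \<longlonglongrightarrow> l i"
    by (metis insertCI)
  obtain m r where r: "m \<in> D" "strict_mono r" "(\<lambda>k. x (s (r k)) j) \<longlonglongrightarrow> m"
    using insert.prems[of j s] s(1) by auto
  have "(\<lambda>k. x (s (r k)) i) \<longlonglongrightarrow> l i" if "i \<in> I" for i
    using LIMSEQ_subseq_LIMSEQ[OF s(3)[OF that] r(2)] by (simp add: o_def)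
  then have "\<forall>i\<in>insert j I. (l(j := m)) i \<in> D \<and> (\<lambda>k. x ((s \<circ> r) k) i) \<longlonglongrightarrow> (l(j := m)) i"
    using r(1,3) s(2) insert.hyps by auto
  then show ?case
    using strict_mono_o[OF s(1) r(2)] by blast
qed

lemma tendsto_symmetrization:
  assumes "(f \<longlongrightarrow> l) F"
  shows "((\<lambda>k. symmetrization (f k)) \<longlongrightarrow> symmetrization l) F"
  unfolding symmetrization_def elem_sym_def
  by (intro vec_tendstoI) (simp, intro tendsto_intros assms)

text \<open>If the distances failed to tend to infinity,
  \<open>caratheodory_dist_sym_product_large\<close> would keep all roots within bounded distance of
  \<open>a\<close> along a subsequence. A further subsequence of root tuples converges entrywise in
  \<open>D\<close>, and its symmetrization is a forbidden accumulation point.\<close>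

lemma c_finitely_compact_sym_product:
  assumes "is_domain D" and fc: "c_finitely_compact disc_maps D"
  shows "c_finitely_compact disc_maps_vec (sym_product D :: (complex ^ 'n::{finite,linorder}) set)"
  unfolding c_finitely_compact_def
proof (intro conjI allI impI)
  show "caratheodory_hyperbolic disc_maps_vec (sym_product D :: (complex, 'n) vec set)"
    using assms by (intro caratheodory_hyperbolic_sym_product)
      (auto simp: is_domain_def c_finitely_compact_def)
next
  fix z :: "nat \<Rightarrow> (complex, 'n) vec"
  let ?S = "sym_product D :: (complex, 'n) vec set"
  let ?c = "caratheodory_dist disc_maps_vec ?S (z 0)"
  assume "range z \<subseteq> ?S \<and> \<not> (\<exists>a\<in>?S. \<exists>r. strict_mono r \<and> (z \<circ> r) \<longlonglongrightarrow> a)"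
  then have z: "\<And>k. z k \<in> ?S" and no_acc: "\<And>a r. a \<in> ?S \<Longrightarrow> strict_mono r \<Longrightarrow> \<not> (z \<circ> r) \<longlonglongrightarrow> a"
    by auto
  obtain a where a: "a \<in> D"
    using assms(1) by (auto simp: is_domain_def)
  show "(\<lambda>k. ?c (z k)) \<longlonglongrightarrow> \<infinity>"
    unfolding tendsto_PInfty
  proof (rule allI, rule ccontr)
    fix R
    assume "\<not> eventually (\<lambda>k. ereal R < ?c (z k)) sequentially"
    from not_eventually_sequentiallyD[OF this]
    obtain s :: "nat \<Rightarrow> nat" where s: "strict_mono s" "\<And>k. \<not> ereal R < ?c (z (s k))"
      by blast
    obtain M where M: "\<And>w j. w \<in> ?S \<Longrightarrow>
        ereal M < caratheodory_dist disc_maps D a (roots_in D w $ j) \<Longrightarrow> ereal R < ?c w"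
      using caratheodory_dist_sym_product_large[OF assms(1) a z[of 0], of R] by blast
    have bound: "\<not> ereal M < caratheodory_dist disc_maps D a (roots_in D (z (s k)) $ j)" for k j
      using M[OF z] s(2) by blast
    have "\<exists>l r. strict_mono r \<and> (\<forall>i\<in>UNIV. l i \<in> D \<and> (\<lambda>k. roots_in D (z (s (r k))) $ i) \<longlonglongrightarrow> l i)"
      by (rule common_convergent_subseq, simp,
          rule c_finitely_compact_convergent_subseq[OF fc a roots_in(1)[OF z] bound])
    then obtain l r where r: "strict_mono r" "\<And>i. l i \<in> D"
        "\<And>i. (\<lambda>k. roots_in D (z (s (r k))) $ i) \<longlonglongrightarrow> l i"
      by auto
    have "(\<lambda>k. roots_in D (z (s (r k)))) \<longlonglongrightarrow> (\<chi> i. l i)"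
      by (intro vec_tendstoI) (simp add: r(3))
    then have "(z \<circ> (s \<circ> r)) \<longlonglongrightarrow> symmetrization (\<chi> i. l i)"
      using tendsto_symmetrization by (fastforce simp: roots_in(2)[OF z] o_def)
    moreover have "symmetrization (\<chi> i. l i) \<in> ?S"
      using r(2) by (intro sym_productI) simp
    ultimately show False
      using no_acc strict_mono_o[OF s(1) r(1)] by blast
  qed
qed

subsection \<open>Embedding the domain into its symmetric product\<close>

definition sym_embed :: "'n::{finite,linorder} \<Rightarrow> complex \<Rightarrow> complex \<Rightarrow> complex ^ 'n::{finite,linorder}" where
  "sym_embed j a t = symmetrization (\<chi> i. if i = j then t else a)"

lemma sym_embed_in_sym_product: "a \<in> D \<Longrightarrow> t \<in> D \<Longrightarrow> sym_embed j a t \<in> sym_product D"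
  unfolding sym_embed_def by (rule sym_productI) simp

lemma elem_sym_1: "elem_sym 1 x = (\<Sum>i\<in>UNIV. x $ i)"
  using newton_identity[of x 1] by (simp add: algebra_simps)

text \<open>The first coordinate recovers the parameter affinely, which yields both the injectivity
  of the embedding and the convergence of parameters from that of images.\<close>

lemma sym_coord_1_sym_embed:
  fixes j :: "'n::{finite,linorder}"
  shows "sym_coord (sym_embed j a t) 1 = t + (of_nat CARD('n) - 1) * a"
proof -
  have "(\<Sum>i\<in>UNIV. if i = j then t else a) = t + (\<Sum>i\<in>UNIV - {j}. a)"
    by (subst sum.remove[of _ j]) (auto intro!: sum.cong)
  then show ?thesis
    by (simp add: sym_embed_def sym_coord_symmetrization elem_sym_1 card_Diff_subset del: One_nat_def)
qed

text \<open>Both tuples have the same root polynomial, and \<open>t\<close> is a root of it.\<close>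

lemma sym_embed_eq_symmetrizationD:
  fixes x :: "complex ^ 'n::{finite,linorder}"
  assumes "sym_embed j a t = symmetrization x"
  shows "\<exists>i. x $ i = t"
proof -
  have "root_poly (sym_embed j a t) t = 0"
    unfolding sym_embed_def root_poly_symmetrization by (intro prod_zero) auto
  then show ?thesis
    by (auto simp: assms root_poly_symmetrization)
qed

lemma tendsto_sym_embed:
  assumes "(f \<longlongrightarrow> l) F"
  shows "((\<lambda>k. sym_embed j a (f k)) \<longlongrightarrow> sym_embed j a l) F"
  unfolding sym_embed_def
  by (intro tendsto_symmetrization vec_tendstoI) (simp add: assms)

lemma tendsto_sym_coord:
  assumes "(f \<longlongrightarrow> l) F"
  shows "((\<lambda>k. sym_coord (f k) m) \<longlongrightarrow> sym_coord l m) F"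
  unfolding sym_coord_def by (cases "m = 0") (auto intro!: tendsto_intros assms)

text \<open>The derivative is put in the form \<open>h *s d\<close> so that the complex homogeneity
  demanded by \<open>holomorphic_vec_on\<close> applies directly after composition.\<close>

lemma has_derivative_vec_lambda:
  fixes f :: "'n::finite \<Rightarrow> complex \<Rightarrow> complex"
  assumes "\<And>i. (f i has_field_derivative d i) (at t within T)"
  shows "((\<lambda>t. \<chi> i. f i t) has_derivative (\<lambda>h. h *s (\<chi> i. d i))) (at t within T)"
  unfolding has_derivative_within
proof
  show "bounded_linear (\<lambda>h. h *s (\<chi> i. d i))"
    unfolding linear_conv_bounded_linear[symmetric]
    by (intro linearI) (simp_all add: vec_eq_iff algebra_simps)
  show "((\<lambda>y. (1 / norm (y - t)) *\<^sub>R ((\<chi> i. f i y) - ((\<chi> i. f i t) + (y - t) *s (\<chi> i. d i)))) \<longlongrightarrow> 0)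
      (at t within T)"
  proof (rule vec_tendstoI)
    fix i
    show "((\<lambda>y. ((1 / norm (y - t)) *\<^sub>R ((\<chi> i. f i y) - ((\<chi> i. f i t) + (y - t) *s (\<chi> i. d i)))) $ i)
        \<longlongrightarrow> 0 $ i) (at t within T)"
      using assms[of i] by (simp add: has_field_derivative_def has_derivative_within algebra_simps)
  qed
qed

lemma sym_embed_holomorphic: "(\<lambda>t. sym_embed j a t $ i) holomorphic_on T"
proof -
  have "(\<lambda>t. if k = j then t else a) holomorphic_on T" for k
    by (cases "k = j") (auto intro: holomorphic_intros)
  then show ?thesis
    unfolding sym_embed_def symmetrization_def elem_sym_def
    by (simp, intro holomorphic_intros)
qed

lemma disc_maps_compose_sym_embed:
  fixes j :: "'n::{finite,linorder}"
  assumes "open D" "a \<in> D" "F \<in> disc_maps_vec (sym_product D)"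
  shows "(\<lambda>t. F (sym_embed j a t)) \<in> disc_maps D"
proof -
  have "(\<lambda>t. F (sym_embed j a t)) field_differentiable at t within D" if "t \<in> D" for t
  proof -
    let ?d = "\<chi> i. deriv (\<lambda>t. sym_embed j a t $ i) t"
    have "((\<lambda>t. sym_embed j a t $ i) has_field_derivative ?d $ i) (at t within D)" for i
      using holomorphic_derivI[OF sym_embed_holomorphic assms(1) that]
      by (simp add: has_field_derivative_at_within)
    from has_derivative_vec_lambda[where f = "\<lambda>i t. sym_embed j a t $ i", OF this]
    have d: "(sym_embed j a has_derivative (\<lambda>h. h *s ?d)) (at t within D)"
      by simp
    have "F holomorphic_vec_on sym_product D"
      using assms(3) by (simp add: disc_maps_vec_def)
    then obtain F' where F': "(F has_derivative F') (at (sym_embed j a t) within sym_product D)"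
        "\<And>c v. F' (c *s v) = c * F' v"
      unfolding holomorphic_vec_on_def using sym_embed_in_sym_product[of a D t j] assms(2) \<open>t \<in> D\<close> by metis
    have "((\<lambda>t. F (sym_embed j a t)) has_derivative (\<lambda>h. F' (h *s ?d))) (at t within D)"
      using assms(2) sym_embed_in_sym_product
      by (intro has_derivative_in_compose[OF d] has_derivative_subset[OF F'(1)]) auto
    then have "((\<lambda>t. F (sym_embed j a t)) has_field_derivative F' ?d) (at t within D)"
      by (simp add: F'(2) has_field_derivative_def mult_commute_abs)
    then show ?thesis
      by (auto simp: field_differentiable_def)
  qed
  then show ?thesis
    using assms(2,3) sym_embed_in_sym_product[of a D _ j]
    by (auto simp: disc_maps_def disc_maps_vec_def holomorphic_on_def image_subset_iff)
qed

text \<open>Pulling back along the embedding turns every competitor for the left supremum into one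
  for the right with the same value.\<close>

lemma caratheodory_dist_sym_embed_le:
  assumes "open D" "a \<in> D"
  shows "caratheodory_dist disc_maps_vec (sym_product D) (sym_embed j a s) (sym_embed j a t)
    \<le> caratheodory_dist disc_maps D s t"
  unfolding caratheodory_dist_def
proof (rule SUP_mono)
  fix F assume "F \<in> {F \<in> disc_maps_vec (sym_product D). F (sym_embed j a s) = 0}"
  then show "\<exists>G\<in>{G \<in> disc_maps D. G s = 0}.
      ereal (poincare_dist 0 (F (sym_embed j a t))) \<le> ereal (poincare_dist 0 (G t))"
    using disc_maps_compose_sym_embed[OF assms, of F j]
    by (intro bexI[of _ "\<lambda>t. F (sym_embed j a t)"]) auto
qed

lemma sym_embed_inj: "sym_embed j a s = sym_embed j a t \<longleftrightarrow> s = t"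
  by (metis add_right_cancel sym_coord_1_sym_embed)

lemma caratheodory_hyperbolic_if_sym_product:
  assumes "open D"
    and "caratheodory_hyperbolic disc_maps_vec (sym_product D :: (complex ^ 'n::{finite,linorder}) set)"
  shows "caratheodory_hyperbolic disc_maps D"
  unfolding caratheodory_hyperbolic_def
proof (intro ballI impI)
  fix s t assume "s \<in> D" "t \<in> D" "s \<noteq> t"
  fix j :: 'n
  \<comment> \<open>The repeated entry of the embedding is taken to be \<open>s\<close> itself,
    which lies in \<open>D\<close>.\<close>
  have "0 < caratheodory_dist disc_maps_vec (sym_product D) (sym_embed j s s) (sym_embed j s t)"
    using assms(2) \<open>s \<in> D\<close> \<open>t \<in> D\<close> \<open>s \<noteq> t\<close>
    by (auto simp: caratheodory_hyperbolic_def sym_embed_inj sym_embed_in_sym_product)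
  also have "\<dots> \<le> caratheodory_dist disc_maps D s t"
    by (intro caratheodory_dist_sym_embed_le assms \<open>s \<in> D\<close>)
  finally show "0 < caratheodory_dist disc_maps D s t" .
qed

text \<open>The embedding has closed image in the symmetric product: an accumulation point of
  embedded points comes from an accumulation point of parameters in \<open>D\<close>. Distances in
  \<open>D\<close> dominate those of the images.\<close>

lemma c_finitely_compact_if_sym_product:
  assumes "open D"
    and fc: "c_finitely_compact disc_maps_vec (sym_product D :: (complex ^ 'n::{finite,linorder}) set)"
  shows "c_finitely_compact disc_maps D"
  unfolding c_finitely_compact_def
proof (intro conjI allI impI)
  show "caratheodory_hyperbolic disc_maps D"
    using fc by (intro caratheodory_hyperbolic_if_sym_product[OF assms(1)])
      (auto simp: c_finitely_compact_def)
next
  fix x :: "nat \<Rightarrow> complex"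
  let ?S = "sym_product D :: (complex, 'n) vec set"
  assume "range x \<subseteq> D \<and> \<not> (\<exists>a\<in>D. \<exists>r. strict_mono r \<and> (x \<circ> r) \<longlonglongrightarrow> a)"
  then have x: "\<And>k. x k \<in> D" and no_acc: "\<And>a r. a \<in> D \<Longrightarrow> strict_mono r \<Longrightarrow> \<not> (x \<circ> r) \<longlonglongrightarrow> a"
    by auto
  fix j :: 'n
  define z where "z = (\<lambda>k. sym_embed j (x 0) (x k))"
  have "\<not> (z \<circ> r) \<longlonglongrightarrow> w" if "w \<in> ?S" "strict_mono r" for w r
  proof
    assume lim: "(z \<circ> r) \<longlonglongrightarrow> w"
    let ?b = "(of_nat CARD('n) - 1) * x 0"
    \<comment> \<open>The parameter obtained by solving \<open>sym_coord_1_sym_embed\<close> at the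
      limit \<open>w\<close>.\<close>
    let ?l = "sym_coord w 1 - ?b"
    have "(\<lambda>k. sym_coord (z (r k)) 1 - ?b) \<longlonglongrightarrow> ?l"
      using lim by (intro tendsto_intros tendsto_sym_coord) (simp add: o_def)
    then have l: "(\<lambda>k. x (r k)) \<longlonglongrightarrow> ?l"
      unfolding z_def sym_coord_1_sym_embed by simp
    from tendsto_sym_embed[OF this, of j "x 0"] have "sym_embed j (x 0) ?l = w"
      using lim by (intro LIMSEQ_unique) (simp_all add: z_def o_def)
    \<comment> \<open>So far \<open>?l\<close> is only a complex number; as a root of
      \<open>root_poly w\<close> it is an entry of \<open>roots_in D w\<close>, and these lie in
      \<open>D\<close>.\<close>
    then have "?l \<in> D"
      using sym_embed_eq_symmetrizationD[of j "x 0" ?l "roots_in D w"] roots_in[OF that(1)] by metis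
    with l no_acc[of ?l r] that(2) show False
      by (simp add: o_def)
  qed
  moreover have "range z \<subseteq> ?S"
    by (auto simp: z_def x intro!: sym_embed_in_sym_product)
  ultimately have "(\<lambda>k. caratheodory_dist disc_maps_vec ?S (z 0) (z k)) \<longlonglongrightarrow> \<infinity>"
    using fc unfolding c_finitely_compact_def by blast
  then show "(\<lambda>k. caratheodory_dist disc_maps D (x 0) (x k)) \<longlonglongrightarrow> \<infinity>"
    unfolding tendsto_PInfty
  proof (rule all_forward)
    fix R
    assume "eventually (\<lambda>k. ereal R < caratheodory_dist disc_maps_vec ?S (z 0) (z k)) sequentially"
    then show "eventually (\<lambda>k. ereal R < caratheodory_dist disc_maps D (x 0) (x k)) sequentially"
      by (rule eventually_mono)
        (simp add: z_def less_le_trans[OF _ caratheodory_dist_sym_embed_le[OF assms(1) x]])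
  qed
qed

theorem proposition18:
  fixes D :: "complex set"
  assumes "is_domain D"
  shows "(caratheodory_hyperbolic disc_maps D \<longleftrightarrow>
          caratheodory_hyperbolic disc_maps_vec (sym_product D :: (complex ^ 'n::{finite,linorder}) set))
       \<and> (c_finitely_compact disc_maps D \<longleftrightarrow>
          c_finitely_compact disc_maps_vec (sym_product D :: (complex ^ 'n::{finite,linorder}) set))"
proof -
  have "open D"
    using assms by (simp add: is_domain_def)
  then show ?thesis
    using assms caratheodory_hyperbolic_sym_product caratheodory_hyperbolic_if_sym_product
      c_finitely_compact_sym_product c_finitely_compact_if_sym_product by blast
qed

end
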